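(* Let $k\ge 3$, let $n>2$, $t\ge 1$ with $n>kt$, and let $\mathtt{Base}$ be a binary consensus protocol for $n>kt$ processes (i.e. a protocol solving binary Byzantine consensus among $n$ processes of which at most $t$ are faulty). Let $\mathtt{CC3}=L_3\odot\mathtt{Base}$ be the composition of the layer $L_3$ with $\mathtt{Base}$. Then $\mathtt{CC3}$ is a binary consensus protocol (every run with at most $t$ faulty processes satisfies Decision, Agreement and Validity) in which: 1. In failure-free runs, decisions occur after 3 rounds (at time 3) and at most $n(t+1.5)$ bits are communicated. 2. When failures occur, at most $n(t+1.5)+2n^2$ bits are sent, and 4 rounds elapse, before reverting to the base protocol. 3. In the common case (failure-free runs), $\mathtt{CC3}$ decides on the majority value $MAJ(v_0,\dots,v_{n-1})$.
   Context: **Model.** There is a set $\mathbb{P}=\{0,\dots,n-1\}$ of $n>2$ processes, every pair connected by a reliable two-way link; receivers know the identity of the sender. Time is discrete and global, starting at $0$; round $m+1$ takes place between times $m$ and $m+1$, and a message sent at time $m$ is received by time $m+1$. The local state of process $i$ at time $m$ consists of its initial value $v_i$, the time $m$, and the sequence of its actions so far, including messages sent and received. A protocol is a deterministic function from local states to messages sent and decisions; protocols know $n$ and $t$. In each run a process is either correct (follows the protocol) or faulty (Byzantine: behaves arbitrarily). At most $t$ processes are faulty in each run, where $1\le t<n$. A run is failure-free if no process is faulty in it. **Consensus.** Each process $i$ starts with $v_i\in V$; in binary consensus $V=\{0,1\}$. A consensus protocol is one all of whose runs (with at most $t$ faulty processes) satisfy: *Decision*: every correct process eventually decides; *Agreement*: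 all correct processes make the same decision; *Validity*: if all correct processes have the same initial value, then all correct processes decide on this value. **Majority.** $MAJ:\{0,1\}^n\to\{0,1\}$ equals $1$ if at least $n/2$ of the votes are $1$, and $0$ otherwise. **Layer $L_3$ composed with $\mathtt{Base}$.** The committee (Council) is $\{0,1,\dots,t\}$. - Time 0, every process $i$: for each $j\in\{0,\dots,t\}$, if $j\bmod 2=v_i$ send nothing to $j$; else send $v_i$ to $j$. - Time 1, every $j\in\{0,\dots,t\}$: for each $i$ set $\mathtt{values}_j[i]:=j\bmod 2$ if no message from $i$ was received, and $(j+1)\bmod 2$ otherwise. Set $rec_j:=MAJ(\mathtt{values}_j)$. For each process $i$: if $i\bmod 2=rec_j$ send nothing to $i$; else send $rec_j$ to $i$. - Time 2, every process $i$ (the recommendation of $j\in\{0,\dots,t\}$ to $i$ is $i\bmod 2$ if $i$ received no round-2 message from $j$, and $(i+1)\bmod 2$ otherwise): if $i$ received a unanimous recommendation $rec$ from $\{0,\dots,t\}$, set $est_i:=rec$ and send nothing. Else set $est_i:=v_i$ and send an 'err' message to all. - Time 3, every process $i$: if no 'err' message was received, decide $est_i$ and send nothing. Else send a 'help' message to all. - Time 4 and beyond, every process $i$: if no 'help' message was received, halt. Else execute $\mathtt{Base}$ with initial value $est_i$ (time 4 acting as time 0 of $\mathtt{Base}$), letting $\mathsf{dec}$ be the value it decides; if $i$ did not decide at time 3, it decides $\mathsf{dec}$. **Conventions.** "To all" includes the sender itself: a process receives the messages it sends to itself, but these are local and cost no bits. Messages other than 'err' in round 3 and other than 'help' in round 4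 are ignored. Each message of the layer (a binary value, 'err' or 'help') costs one bit. Bit counts refer to bits sent by correct processes. "Before reverting to the base protocol" means: in the rounds preceding the start of $\mathtt{Base}$; all communication by correct processes afterwards is that of $\mathtt{Base}$. *)

theory Defs
  imports Complex_Main
begin

section \<open>Synchronous message passing with Byzantine processes\<close>

text \<open>The processes are \<open>0, \<dots>, n - 1\<close>. An action is what a process does at one point in time:
  \<open>msgs a j\<close> is the message (if any) it sends to \<open>j\<close>, and \<open>decision a\<close> the value (if any) on which
  it decides.\<close>

record ('v, 'm) action =
  msgs :: "nat \<Rightarrow> 'm option"
  decision :: "'v option"

text \<open>Entry \<open>m\<close> of the history consists of the action taken at time \<open>m\<close> and the messages received,
  by sender, in round \<open>m + 1\<close>, that is, between times \<open>m\<close> and \<open>m + 1\<close>.\<close>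

record ('v, 'm) lstate =
  initial :: 'v
  now :: nat
  hist :: "(('v, 'm) action \<times> (nat \<Rightarrow> 'm option)) list"

text \<open>The first argument of a protocol is the identity of the process executing it.\<close>

type_synonym ('v, 'm) protocol = "nat \<Rightarrow> ('v, 'm) lstate \<Rightarrow> ('v, 'm) action"

text \<open>\<open>acts r m i\<close> is the action of process \<open>i\<close> at time \<open>m\<close>.\<close>

record ('v, 'm) run =
  faulty :: "nat set"
  inits :: "nat \<Rightarrow> 'v"
  acts :: "nat \<Rightarrow> nat \<Rightarrow> ('v, 'm) action"

definition correct :: "nat \<Rightarrow> ('v, 'm) run \<Rightarrow> nat set" where
  "correct n r = {..<n} - faulty r"

definition received :: "nat \<Rightarrow> ('v, 'm) run \<Rightarrow> nat \<Rightarrow> nat \<Rightarrow> nat \<Rightarrow> 'm option" where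
  "received n r i m = (\<lambda>j. if j < n then msgs (acts r m j) i else None)"

definition local_state :: "nat \<Rightarrow> ('v, 'm) run \<Rightarrow> nat \<Rightarrow> nat \<Rightarrow> ('v, 'm) lstate" where
  "local_state n r i m =
     \<lparr>initial = inits r i, now = m, hist = map (\<lambda>l. (acts r l i, received n r i l)) [0..<m]\<rparr>"

definition is_run :: "nat \<Rightarrow> nat \<Rightarrow> ('v, 'm) protocol \<Rightarrow> ('v, 'm) run \<Rightarrow> bool" where
  "is_run n t P r \<longleftrightarrow>
     faulty r \<subseteq> {..<n} \<and> card (faulty r) \<le> t \<and>
     (\<forall>i\<in>correct n r. \<forall>m. acts r m i = P i (local_state n r i m))"

definition failure_free :: "('v, 'm) run \<Rightarrow> bool" where
  "failure_free r \<longleftrightarrow> faulty r = {}"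

definition decides_at :: "('v, 'm) run \<Rightarrow> nat \<Rightarrow> nat \<Rightarrow> 'v \<Rightarrow> bool" where
  "decides_at r i m d \<longleftrightarrow> decision (acts r m i) = Some d"

definition decides :: "('v, 'm) run \<Rightarrow> nat \<Rightarrow> 'v \<Rightarrow> bool" where
  "decides r i d \<longleftrightarrow> (\<exists>m. decides_at r i m d)"

section \<open>Consensus\<close>

definition Decision :: "nat \<Rightarrow> ('v, 'm) run \<Rightarrow> bool" where
  "Decision n r \<longleftrightarrow> (\<forall>i\<in>correct n r. \<exists>d. decides r i d)"

text \<open>The case \<open>i = j\<close> is included, so decisions are irrevocable: a correct process may repeat its
  decision but not change it.\<close>

definition Agreement :: "nat \<Rightarrow> ('v, 'm) run \<Rightarrow> bool" where
  "Agreement n r \<longleftrightarrow>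
     (\<forall>i\<in>correct n r. \<forall>j\<in>correct n r. \<forall>d d'. decides r i d \<longrightarrow> decides r j d' \<longrightarrow> d = d')"

definition Validity :: "nat \<Rightarrow> ('v, 'm) run \<Rightarrow> bool" where
  "Validity n r \<longleftrightarrow>
     (\<forall>v. (\<forall>i\<in>correct n r. inits r i = v) \<longrightarrow> (\<forall>i\<in>correct n r. decides r i v))"

text \<open>The set of values is the type \<open>'v\<close>; binary consensus is the instance \<open>'v = bool\<close>, with
  \<open>False\<close> for 0 and \<open>True\<close> for 1.\<close>

definition consensus_protocol :: "nat \<Rightarrow> nat \<Rightarrow> ('v, 'm) protocol \<Rightarrow> bool" where
  "consensus_protocol n t P \<longleftrightarrow>
     (\<forall>r. is_run n t P r \<longrightarrow> Decision n r \<and> Agreement n r \<and> Validity n r)"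

definition MAJ :: "nat \<Rightarrow> (nat \<Rightarrow> bool) \<Rightarrow> bool" where
  "MAJ n w \<longleftrightarrow> real (card {i \<in> {..<n}. w i}) \<ge> real n / 2"

section \<open>Counting bits\<close>

text \<open>The bits sent by correct processes in the first \<open>T\<close> rounds; messages to oneself are free.\<close>

definition bits_sent :: "('m \<Rightarrow> nat) \<Rightarrow> nat \<Rightarrow> ('v, 'm) run \<Rightarrow> nat \<Rightarrow> nat" where
  "bits_sent c n r T =
     (\<Sum>m<T. \<Sum>i\<in>correct n r. \<Sum>j\<in>{..<n} - {i}.
        (case msgs (acts r m i) j of None \<Rightarrow> 0 | Some x \<Rightarrow> c x))"

section \<open>The layer composed with a base protocol\<close>

datatype 'm msg = Bit bool | Err | Help | BaseMsg 'm

text \<open>The parameter \<open>c\<close> is the cost in bits of the messages of the base protocol.\<close>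

fun msg_bits :: "('m \<Rightarrow> nat) \<Rightarrow> 'm msg \<Rightarrow> nat" where
  "msg_bits c (Bit b) = 1"
| "msg_bits c Err = 1"
| "msg_bits c Help = 1"
| "msg_bits c (BaseMsg x) = c x"

fun base_part :: "'m msg option \<Rightarrow> 'm option" where
  "base_part (Some (BaseMsg x)) = Some x"
| "base_part _ = None"

text \<open>The local state of process \<open>i\<close> when it has followed \<open>P\<close> from initial value \<open>w\<close> and has
  received, round by round, the messages in \<open>rs\<close>.\<close>

definition replay ::
  "('v, 'm) protocol \<Rightarrow> nat \<Rightarrow> 'v \<Rightarrow> (nat \<Rightarrow> 'm option) list \<Rightarrow> ('v, 'm) lstate" where
  "replay P i w rs =
     fold (\<lambda>rc s. s\<lparr>now := Suc (now s), hist := hist s @ [(P i s, rc)]\<rparr>) rs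
       \<lparr>initial = w, now = 0, hist = []\<rparr>"

definition rcvd :: "('v, 'm) lstate \<Rightarrow> nat \<Rightarrow> nat \<Rightarrow> 'm option" where
  "rcvd s m = snd (hist s ! m)"

definition silent :: "('v, 'm) action" where
  "silent = \<lparr>msgs = (\<lambda>_. None), decision = None\<rparr>"

definition to_all :: "nat \<Rightarrow> 'm \<Rightarrow> nat \<Rightarrow> 'm option" where
  "to_all n x = (\<lambda>j. if j < n then Some x else None)"

text \<open>As bits, \<open>j mod 2\<close> is \<open>odd j\<close> and \<open>(j + 1) mod 2\<close> is \<open>even j\<close>.\<close>

definition council_values :: "nat \<Rightarrow> (bool, 'm msg) lstate \<Rightarrow> nat \<Rightarrow> bool" where
  "council_values j s = (\<lambda>i. if rcvd s 0 i = None then odd j else even j)"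

definition council_rec :: "nat \<Rightarrow> nat \<Rightarrow> (bool, 'm msg) lstate \<Rightarrow> bool" where
  "council_rec n j s = MAJ n (council_values j s)"

definition recommendation :: "nat \<Rightarrow> (bool, 'm msg) lstate \<Rightarrow> nat \<Rightarrow> bool" where
  "recommendation i s = (\<lambda>j. if rcvd s 1 j = None then odd i else even i)"

definition unanimous :: "nat \<Rightarrow> nat \<Rightarrow> (bool, 'm msg) lstate \<Rightarrow> bool" where
  "unanimous t i s \<longleftrightarrow> (\<exists>d. \<forall>j\<in>{0..t}. recommendation i s j = d)"

definition est :: "nat \<Rightarrow> nat \<Rightarrow> (bool, 'm msg) lstate \<Rightarrow> bool" where
  "est t i s = (if unanimous t i s then recommendation i s 0 else initial s)"

definition got_err :: "nat \<Rightarrow> (bool, 'm msg) lstate \<Rightarrow> bool" where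
  "got_err n s \<longleftrightarrow> (\<exists>j<n. rcvd s 2 j = Some Err)"

definition got_help :: "nat \<Rightarrow> (bool, 'm msg) lstate \<Rightarrow> bool" where
  "got_help n s \<longleftrightarrow> (\<exists>j<n. rcvd s 3 j = Some Help)"

text \<open>The state of the execution of the base protocol inside the composition. It is recomputed from
  the messages received since time 4, because a process that decided at time 3 does not carry out
  the decision of the base protocol, which therefore is missing from its history.\<close>

definition base_state ::
  "nat \<Rightarrow> (bool, 'm) protocol \<Rightarrow> nat \<Rightarrow> (bool, 'm msg) lstate \<Rightarrow> (bool, 'm) lstate" where
  "base_state t Base i s =
     replay Base i (est t i s) (map (\<lambda>(a, rc). base_part \<circ> rc) (drop 4 (hist s)))"

text \<open>The composition of the layer \<open>L\<^sub>3\<close> with \<open>Base\<close>. Halting means remaining silent forever: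
  whether help was received is read off the fixed history entry of round 4.\<close>

definition CC3 :: "nat \<Rightarrow> nat \<Rightarrow> (bool, 'm) protocol \<Rightarrow> (bool, 'm msg) protocol" where
  "CC3 n t Base i s =
    (if now s = 0 then
       \<lparr>msgs = (\<lambda>j. if j \<in> {0..t} \<and> odd j \<noteq> initial s then Some (Bit (initial s)) else None),
        decision = None\<rparr>
     else if now s = 1 then
       (let b = council_rec n i s in
        \<lparr>msgs = (\<lambda>j. if i \<in> {0..t} \<and> j < n \<and> odd j \<noteq> b then Some (Bit b) else None),
         decision = None\<rparr>)
     else if now s = 2 then
       (if unanimous t i s then silent else \<lparr>msgs = to_all n Err, decision = None\<rparr>)
     else if now s = 3 then
       (if \<not> got_err n s then \<lparr>msgs = (\<lambda>_. None), decision = Some (est t i s)\<rparr>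
        else \<lparr>msgs = to_all n Help, decision = None\<rparr>)
     else if \<not> got_help n s then silent
     else
       (let a = Base i (base_state t Base i s) in
        \<lparr>msgs = map_option BaseMsg \<circ> msgs a,
         decision = (if decision (fst (hist s ! 3)) = None then decision a else None)\<rparr>))"

text \<open>Process \<open>i\<close> sends no message of \<open>Base\<close> before time \<open>T\<close>, and from then on its communication is
  that of \<open>Base\<close> started at time \<open>T\<close> with initial value \<open>w\<close>.\<close>

definition reverts_at ::
  "nat \<Rightarrow> (bool, 'm) protocol \<Rightarrow> (bool, 'm msg) run \<Rightarrow> nat \<Rightarrow> nat \<Rightarrow> bool \<Rightarrow> bool" where
  "reverts_at n Base r i T w \<longleftrightarrow>
     (\<forall>m<T. \<forall>j x. msgs (acts r m i) j \<noteq> Some (BaseMsg x)) \<and>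
     (\<forall>m. msgs (acts r (T + m) i) =
        map_option BaseMsg \<circ>
          msgs (Base i (replay Base i w
            (map (\<lambda>l. base_part \<circ> received n r i (T + l)) [0..<m]))))"

text \<open>Process \<open>i\<close> never starts \<open>Base\<close>: it sends no message of \<open>Base\<close>, and is silent from time \<open>T\<close>.\<close>

definition halts_at :: "(bool, 'm msg) run \<Rightarrow> nat \<Rightarrow> nat \<Rightarrow> bool" where
  "halts_at r i T \<longleftrightarrow>
     (\<forall>m<T. \<forall>j x. msgs (acts r m i) j \<noteq> Some (BaseMsg x)) \<and> (\<forall>m\<ge>T. acts r m i = silent)"

end

(* A correct council member sends the same recommendation to everyone, and the council has one
   because it has t + 1 members; hence correct processes with a unanimous recommendation share the
   same estimate. If some correct process decides at time 3, it received no err, so every correct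
   process had a unanimous recommendation and all estimates agree: Base, if all execute it, decides
   on that estimate by its validity. If a correct process sends help, all correct processes execute
   Base, and their execution is a genuine run of Base; otherwise all have decided at time 3 and it
   does not matter that faulty processes may make only some of them execute Base. *)
theory Submission
  imports Defs
begin

section \<open>Runs\<close>

lemma rcvd_local_state [simp]: "l < m \<Longrightarrow> rcvd (local_state n r i m) l = received n r i l"
  by (simp add: rcvd_def local_state_def)

lemma now_local_state [simp]: "now (local_state n r i m) = m"
  by (simp add: local_state_def)

lemma initial_local_state [simp]: "initial (local_state n r i m) = inits r i"
  by (simp add: local_state_def)

lemma replay_snoc:
  "replay P i w (rs @ [rc]) =
     (replay P i w rs)\<lparr>now := Suc (now (replay P i w rs)),
       hist := hist (replay P i w rs) @ [(P i (replay P i w rs), rc)]\<rparr>"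
  by (simp add: replay_def)

text \<open>The hypothesis makes \<open>i\<close> act as \<open>P\<close> does in the replayed
  states, so by induction over time these are its real local states. This turns actions computed by
  \<open>replay\<close> into a genuine run of \<open>P\<close>.\<close>

lemma local_state_eq_replay:
  assumes "\<And>m. acts r m i = P i (replay P i (inits r i) (map (received n r i) [0..<m]))"
  shows "local_state n r i m = replay P i (inits r i) (map (received n r i) [0..<m])"
proof (induction m)
  case 0
  then show ?case by (simp add: local_state_def replay_def)
next
  case (Suc m)
  have "local_state n r i (Suc m) =
    (local_state n r i m)\<lparr>now := Suc m,
       hist := hist (local_state n r i m) @ [(acts r m i, received n r i m)]\<rparr>"
    by (simp add: local_state_def)
  also have "\<dots> = replay P i (inits r i) (map (received n r i) [0..<m] @ [received n r i m])"
    using now_local_state[of n r i m] unfolding replay_snoc assms[of m] by (simp add: Suc.IH)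
  finally show ?case by simp
qed

lemma base_part_map_BaseMsg [simp]: "base_part (map_option BaseMsg x) = x"
  by (cases x) auto

section \<open>The majority function\<close>

lemma MAJ_cong: "(\<And>i. i < n \<Longrightarrow> v i = w i) \<Longrightarrow> MAJ n v = MAJ n w"
proof -
  assume "\<And>i. i < n \<Longrightarrow> v i = w i"
  then have "{i \<in> {..<n}. v i} = {i \<in> {..<n}. w i}" by auto
  then show "MAJ n v = MAJ n w" by (simp add: MAJ_def)
qed

text \<open>The votes in \<open>F\<close> are fewer than half, so they can neither outvote the
  others nor produce a tie.\<close>

lemma MAJ_eqI:
  assumes "\<And>i. i \<in> {..<n} - F \<Longrightarrow> w i = v" and "finite F" and "2 * card F < n"
  shows "MAJ n w = v"
proof (cases v)
  case True
  have "n - card F \<le> card ({..<n} - F)"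
    using diff_card_le_card_Diff[OF assms(2), of "{..<n}"] by simp
  also have "\<dots> \<le> card {i \<in> {..<n}. w i}"
    using assms(1) True by (intro card_mono) auto
  finally show ?thesis using assms(3) True by (simp add: MAJ_def)
next
  case False
  have "card {i \<in> {..<n}. w i} \<le> card F"
    using assms(1) False by (intro card_mono[OF assms(2)]) blast
  then show ?thesis using assms(3) False by (simp add: MAJ_def)
qed

section \<open>Counting messages\<close>

definition round_bits :: "('m \<Rightarrow> nat) \<Rightarrow> nat \<Rightarrow> ('v, 'm) run \<Rightarrow> nat \<Rightarrow> nat" where
  "round_bits c n r m =
     (\<Sum>i\<in>correct n r. \<Sum>j\<in>{..<n} - {i}.
        (case msgs (acts r m i) j of None \<Rightarrow> 0 | Some x \<Rightarrow> c x))"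

lemma bits_sent_eq_sum_round_bits: "bits_sent c n r T = (\<Sum>m<T. round_bits c n r m)"
  by (simp add: bits_sent_def round_bits_def)

lemma round_bits_eq_card:
  assumes "\<And>i j x. i \<in> correct n r \<Longrightarrow> msgs (acts r m i) j = Some x \<Longrightarrow> c x = 1"
  shows "round_bits c n r m =
    (\<Sum>i\<in>correct n r. card {j \<in> {..<n} - {i}. msgs (acts r m i) j \<noteq> None})"
  unfolding round_bits_def
proof (rule sum.cong[OF refl])
  fix i assume i: "i \<in> correct n r"
  have "(\<Sum>j\<in>{..<n} - {i}. case msgs (acts r m i) j of None \<Rightarrow> 0 | Some x \<Rightarrow> c x) =
      (\<Sum>j\<in>{..<n} - {i}. if msgs (acts r m i) j \<noteq> None then 1 else 0)"
    using assms[OF i] by (intro sum.cong[OF refl]) (auto split: option.split)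
  also have "\<dots> = card {j \<in> {..<n} - {i}. msgs (acts r m i) j \<noteq> None}"
    by (simp add: sum.If_cases Int_def)
  finally show "(\<Sum>j\<in>{..<n} - {i}. case msgs (acts r m i) j of None \<Rightarrow> 0 | Some x \<Rightarrow> c x) =
      card {j \<in> {..<n} - {i}. msgs (acts r m i) j \<noteq> None}" .
qed

lemma card_correct_le: "card (correct n r) \<le> n"
  using card_mono[of "{..<n}" "correct n r"] by (auto simp: correct_def)

lemma finite_correct [simp]: "finite (correct n r)"
  by (simp add: correct_def)

text \<open>These are the recipients of the bit \<open>b\<close> among the first \<open>m\<close>
  processes. If \<open>b\<close> holds they are the even ones, which start with 0 and so get the
  rounding up.\<close>

lemma card_parity: "card {j. j < m \<and> odd j \<noteq> b} = (if b then Suc m div 2 else m div 2)"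
proof (induction m)
  case (Suc m)
  have "{j. j < Suc m \<and> odd j \<noteq> b} =
      (if odd m \<noteq> b then insert m {j. j < m \<and> odd j \<noteq> b} else {j. j < m \<and> odd j \<noteq> b})"
    by (auto simp: less_Suc_eq)
  then have "card {j. j < Suc m \<and> odd j \<noteq> b} =
      (if odd m \<noteq> b then 1 else 0) + card {j. j < m \<and> odd j \<noteq> b}"
    by simp
  then show ?case unfolding Suc by (cases b) (cases "even m"; simp)+
qed simp

text \<open>The saved message of the sender to itself compensates for the rounding up of \<open>n / 2\<close>.\<close>

lemma card_parity_others:
  assumes "i < n"
  shows "card {j \<in> {..<n} - {i}. odd j \<noteq> b} \<le> (if odd i then Suc n div 2 else n div 2)"
proof -
  have halves: "n div 2 \<le> Suc n div 2" "Suc n div 2 \<le> Suc (n div 2)" by linarith+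
  show ?thesis
  proof (cases "odd i \<noteq> b")
    case True
    \<comment> \<open>The sender is itself a recipient. For even \<open>i\<close> the bit is 1, and
      leaving out \<open>i\<close> brings the rounded-up count down to at most
      \<open>n div 2\<close>.\<close>
    have "{j \<in> {..<n} - {i}. odd j \<noteq> b} = {j. j < n \<and> odd j \<noteq> b} - {i}" by auto
    then have "card {j \<in> {..<n} - {i}. odd j \<noteq> b} = card {j. j < n \<and> odd j \<noteq> b} - 1"
      using True assms by (simp add: card_Diff_singleton)
    also have "\<dots> \<le> (if odd i then Suc n div 2 else n div 2)"
      unfolding card_parity using halves by auto
    finally show ?thesis .
  next
    case False
    \<comment> \<open>Nothing is saved here, but \<open>b\<close> equals \<open>odd i\<close>, so
      the count of all recipients is the claimed bound.\<close>
    have "card {j \<in> {..<n} - {i}. odd j \<noteq> b} \<le> card {j. j < n \<and> odd j \<noteq> b}"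
      by (intro card_mono) auto
    also have "\<dots> \<le> (if odd i then Suc n div 2 else n div 2)"
      unfolding card_parity using False halves by auto
    finally show ?thesis .
  qed
qed

text \<open>An even index and the odd one after it together contribute exactly \<open>n\<close>. For
  odd \<open>m\<close> the unpaired last index is even and contributes the half that is rounded
  down.\<close>

lemma sum_parity_halves:
  "2 * (\<Sum>i<m. if odd i then Suc n div 2 else n div 2) \<le> m * n"
proof -
  have halves: "2 * (n div 2) + 2 * (Suc n div 2) = 2 * n" by presburger
  have "2 * (\<Sum>i<m. if odd i then Suc n div 2 else n div 2) =
      (if even m then m * n else (m - 1) * n + 2 * (n div 2))"
  proof (induction m)
    case (Suc m)
    show ?case
    proof (cases "even m")
      case True
      then show ?thesis using Suc by simp
    next
      case False
      then obtain l where "m = Suc l" by (cases m) auto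
      then show ?thesis using Suc halves False by simp
    qed
  qed simp
  then show ?thesis by (cases m) auto
qed

section \<open>Runs of the composition\<close>

locale CC3_run =
  fixes n t :: nat and Base :: "(bool, 'm) protocol" and r :: "(bool, 'm msg) run"
  assumes resilience: "3 * t < n"
    and is_run: "is_run n t (CC3 n t Base) r"
begin

abbreviation state :: "nat \<Rightarrow> nat \<Rightarrow> (bool, 'm msg) lstate" where
  "state \<equiv> local_state n r"

definition rec :: "nat \<Rightarrow> bool" where
  "rec j = council_rec n j (state j 1)"

definition estimate :: "nat \<Rightarrow> bool" where
  "estimate i = est t i (state i 2)"

definition unanimity :: "nat \<Rightarrow> bool" where
  "unanimity i \<longleftrightarrow> unanimous t i (state i 2)"

text \<open>Time 4 of the composition is time 0 of the base protocol. Messages of the layer that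
  faulty processes still send at that stage count as absent.\<close>

definition base_input :: "nat \<Rightarrow> nat \<Rightarrow> nat \<Rightarrow> 'm option" where
  "base_input i l = base_part \<circ> received n r i (4 + l)"

definition base_action :: "nat \<Rightarrow> nat \<Rightarrow> (bool, 'm) action" where
  "base_action m i = Base i (replay Base i (estimate i) (map (base_input i) [0..<m]))"

lemma faulty: "faulty r \<subseteq> {..<n}" "finite (faulty r)" "card (faulty r) \<le> t"
  using is_run finite_subset[of "faulty r" "{..<n}"] by (auto simp: is_run_def)

lemma correct_less: "i \<in> correct n r \<Longrightarrow> i < n"
  by (simp add: correct_def)

lemma acts_correct: "i \<in> correct n r \<Longrightarrow> acts r m i = CC3 n t Base i (state i m)"
  using is_run by (simp add: is_run_def)

text \<open>Past history entries never change; hence whatever is computed from round 2 at time 2 has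
  the same value at every later time.\<close>

lemma recommendation_state:
  "2 \<le> m \<Longrightarrow> recommendation i (state i m) = recommendation i (state i 2)"
  by (simp add: recommendation_def)

lemma unanimous_state: "2 \<le> m \<Longrightarrow> unanimous t i (state i m) = unanimity i"
  unfolding unanimity_def unanimous_def by (metis recommendation_state)

lemma est_state: "2 \<le> m \<Longrightarrow> est t i (state i m) = estimate i"
  using recommendation_state[of m i] unanimous_state[of m i]
  by (simp add: estimate_def est_def unanimity_def)

lemma got_help_state: "4 \<le> m \<Longrightarrow> got_help n (state i m) = got_help n (state i 4)"
  by (simp add: got_help_def)

lemma acts_0:
  "i \<in> correct n r \<Longrightarrow> acts r 0 i =
     \<lparr>msgs = (\<lambda>j. if j \<in> {0..t} \<and> odd j \<noteq> inits r i then Some (Bit (inits r i)) else None),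
      decision = None\<rparr>"
  by (simp add: acts_correct CC3_def cong: if_cong)

lemma acts_1:
  "i \<in> correct n r \<Longrightarrow> acts r 1 i =
     \<lparr>msgs = (\<lambda>j. if i \<in> {0..t} \<and> j < n \<and> odd j \<noteq> rec i then Some (Bit (rec i)) else None),
      decision = None\<rparr>"
  by (simp add: acts_correct CC3_def rec_def Let_def cong: if_cong)

lemma acts_2:
  "i \<in> correct n r \<Longrightarrow> acts r 2 i =
     (if unanimity i then silent else \<lparr>msgs = to_all n Err, decision = None\<rparr>)"
  by (simp add: acts_correct CC3_def unanimous_state)

lemma acts_3:
  "i \<in> correct n r \<Longrightarrow> acts r 3 i =
     (if \<not> got_err n (state i 3) then \<lparr>msgs = (\<lambda>_. None), decision = Some (estimate i)\<rparr>
      else \<lparr>msgs = to_all n Help, decision = None\<rparr>)"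
  by (simp add: acts_correct CC3_def est_state)

lemma base_state_eq:
  "base_state t Base i (state i (4 + m)) =
     replay Base i (estimate i) (map (base_input i) [0..<m])"
proof -
  have "map (\<lambda>(a, rc). base_part \<circ> rc) (drop 4 (hist (state i (4 + m)))) =
      map (\<lambda>l. base_part \<circ> received n r i l) [4..<4 + m]"
    by (simp add: local_state_def drop_map)
  also have "\<dots> = map (base_input i) [0..<m]"
    by (rule nth_equalityI) (simp_all add: base_input_def)
  finally show ?thesis
    by (simp add: base_state_def est_state)
qed

lemma acts_base:
  assumes "i \<in> correct n r"
  shows "acts r (4 + m) i =
     (if got_help n (state i 4) then
        \<lparr>msgs = map_option BaseMsg \<circ> msgs (base_action m i),
         decision =
           (if got_err n (state i 3) then decision (base_action m i) else None)\<rparr>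
      else silent)"
proof -
  have "decision (fst (hist (state i (4 + m)) ! 3)) = decision (acts r 3 i)"
    by (simp add: local_state_def)
  \<comment> \<open>At time 3 a correct process either decides or asks for help, so the test for an
    earlier decision amounts to a test for 'err'.\<close>
  then have "(decision (fst (hist (state i (4 + m)) ! 3)) = None) = got_err n (state i 3)"
    by (simp add: acts_3[OF assms])
  then show ?thesis
    using got_help_state[of "4 + m" i]
    by (simp add: acts_correct[OF assms] CC3_def base_state_eq base_action_def Let_def)
qed

lemma acts_halted:
  "i \<in> correct n r \<Longrightarrow> \<not> got_help n (state i 4) \<Longrightarrow> 4 \<le> m \<Longrightarrow> acts r m i = silent"
  using acts_base[of i "m - 4"] by simp

subsection \<open>Estimates\<close>

text \<open>Only the presence of a message is read, not its content: silence decodes to the parity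
  of the recipient, which is the bit on which a correct sender keeps silent.\<close>

lemma council_values_correct:
  assumes "i \<in> correct n r" and "j \<le> t"
  shows "council_values j (state j 1) i = inits r i"
  using assms correct_less[OF assms(1)] by (simp add: council_values_def received_def acts_0)

lemma recommendation_correct:
  assumes "j \<in> correct n r" and "j \<le> t" and "i < n"
  shows "recommendation i (state i 2) j = rec j"
  using assms correct_less[OF assms(1)]
  by (auto simp: recommendation_def received_def acts_1[unfolded One_nat_def])

lemma correct_council_member: obtains j where "j \<in> correct n r" "j \<le> t"
proof -
  have "\<not> {..t} \<subseteq> faulty r"
    using card_mono[OF faulty(2), of "{..t}"] faulty(3) by auto
  then obtain j where "j \<le> t" "j \<notin> faulty r" by auto
  then show thesis using that resilience by (simp add: correct_def)
qed

text \<open>The estimate is read off member 0, which may be faulty. Unanimity transfers it to the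
  correct member \<open>j\<close>, whose recommendation is decoded as intended.\<close>

lemma estimate_eq_rec:
  assumes "unanimity i" and "i < n" and "j \<in> correct n r" and "j \<le> t"
  shows "estimate i = rec j"
proof -
  have "recommendation i (state i 2) 0 = recommendation i (state i 2) j"
    using assms(1,4) unfolding unanimity_def unanimous_def by fastforce
  then show ?thesis
    using assms by (simp add: estimate_def est_def unanimity_def recommendation_correct)
qed

lemma estimate_agree:
  assumes "unanimity i" "i < n" "unanimity j" "j < n"
  shows "estimate i = estimate j"
  using assms by (metis correct_council_member estimate_eq_rec)

text \<open>At most \<open>t\<close> votes come from faulty processes, and \<open>2 * t < n\<close>.
  Faulty members \<open>j\<close> are covered as well, since \<open>rec\<close> is computed from
  what \<open>j\<close> receives, not from what it sends.\<close>

lemma rec_valid: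
  assumes "\<forall>i\<in>correct n r. inits r i = v" and "j \<le> t"
  shows "rec j = v"
  unfolding rec_def council_rec_def
proof (rule MAJ_eqI)
  show "council_values j (state j 1) i = v" if "i \<in> {..<n} - faulty r" for i
    using that assms council_values_correct by (simp add: correct_def)
qed (use faulty resilience in auto)

lemma estimate_valid:
  assumes "\<forall>i\<in>correct n r. inits r i = v" and "i \<in> correct n r"
  shows "estimate i = v"
proof (cases "unanimity i")
  case True
  then show ?thesis
    using assms by (metis correct_council_member correct_less estimate_eq_rec rec_valid)
next
  case False
  then show ?thesis using assms by (simp add: estimate_def est_def unanimity_def)
qed

lemma unanimity_if_no_err:
  assumes "i \<in> correct n r" "\<not> got_err n (state i 3)" "j \<in> correct n r"
  shows "unanimity j"
proof (rule ccontr)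
  assume "\<not> unanimity j"
  then have "received n r i 2 j = Some Err"
    using assms correct_less by (simp add: received_def acts_2 to_all_def)
  then show False using assms correct_less by (auto simp: got_err_def)
qed

lemma got_help_if_err:
  assumes "j \<in> correct n r" "got_err n (state j 3)" "i \<in> correct n r"
  shows "got_help n (state i 4)"
proof -
  have "received n r i 3 j = Some Help"
    using assms correct_less by (simp add: received_def acts_3 to_all_def)
  then show ?thesis using assms correct_less by (auto simp: got_help_def)
qed

lemma estimate_agree_if_no_err:
  assumes "i \<in> correct n r" "\<not> got_err n (state i 3)" "j \<in> correct n r"
  shows "estimate j = estimate i"
  using assms by (meson estimate_agree unanimity_if_no_err correct_less)

subsection \<open>The embedded run of the base protocol\<close>

text \<open>Correct processes carry out all actions of the base protocol, including decisions that
  the composition suppresses after a decision at time 3. Faulty ones send the base part of what they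
  send four rounds later in \<open>r\<close>.\<close>

definition base_run :: "(bool, 'm) run" where
  "base_run =
     \<lparr>faulty = faulty r, inits = estimate,
      acts = (\<lambda>m i. if i \<in> correct n r then base_action m i
        else \<lparr>msgs = base_part \<circ> msgs (acts r (4 + m) i), decision = None\<rparr>)\<rparr>"

lemma correct_base_run [simp]: "correct n base_run = correct n r"
  by (simp add: correct_def base_run_def)

lemma inits_base_run [simp]: "inits base_run = estimate"
  by (simp add: base_run_def)

text \<open>A halted process is silent in \<open>r\<close> whereas \<open>base_action\<close> may
  send messages; with every correct process having received help, both runs deliver the same base
  messages.\<close>

lemma is_run_base_run:
  assumes "\<forall>i\<in>correct n r. got_help n (state i 4)"
  shows "is_run n t Base base_run"
proof -
  \<comment> \<open>For correct senders \<open>base_part\<close> undoes the wrapping in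
    \<open>BaseMsg\<close>; for faulty ones the equation is built into
    \<open>base_run\<close>.\<close>
  have received: "received n base_run i = base_input i" for i
    by (auto simp: fun_eq_iff received_def base_input_def base_run_def acts_base assms)
  have "acts base_run m i = Base i (local_state n base_run i m)" if "i \<in> correct n r" for i m
  proof -
    have acts: "acts base_run m i =
        Base i (replay Base i (inits base_run i) (map (received n base_run i) [0..<m]))" for m
      using that unfolding received by (simp add: base_run_def base_action_def)
    show ?thesis
      unfolding local_state_eq_replay[where P = Base, OF acts] by (rule acts)
  qed
  then show ?thesis
    using faulty by (simp add: is_run_def) (simp add: base_run_def)
qed

lemma base_run_decides:
  "i \<in> correct n r \<Longrightarrow> decides base_run i d \<longleftrightarrow> (\<exists>m. decision (base_action m i) = Some d)"
  by (simp add: decides_def decides_at_def base_run_def)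

section \<open>Decisions of the composition compared with those of the embedded run\<close>

lemma no_decision_before:
  assumes "i \<in> correct n r" and "m < 3"
  shows "decision (acts r m i) = None"
proof -
  consider "m = 0" | "m = 1" | "m = 2" using assms(2) by linarith
  then show ?thesis
    by cases (use assms(1) in \<open>simp_all add: acts_0 acts_1[unfolded One_nat_def] acts_2 silent_def\<close>)
qed

lemma decides_at_early:
  assumes "i \<in> correct n r" "\<not> got_err n (state i 3)"
  shows "decides_at r i m d \<longleftrightarrow> m = 3 \<and> d = estimate i"
proof -
  consider "m < 3" | "m = 3" | "4 \<le> m" by linarith
  then show ?thesis
  proof cases
    case 1
    then show ?thesis using no_decision_before[OF assms(1)] by (simp add: decides_at_def)
  next
    case 2
    then show ?thesis using assms by (auto simp: decides_at_def acts_3)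
  next
    case 3
    then obtain m' where "m = 4 + m'" using le_Suc_ex by blast
    then show ?thesis using assms by (simp add: decides_at_def acts_base silent_def)
  qed
qed

lemma decides_early:
  "i \<in> correct n r \<Longrightarrow> \<not> got_err n (state i 3) \<Longrightarrow> decides r i d \<longleftrightarrow> d = estimate i"
  by (simp add: decides_def decides_at_early)

text \<open>Whoever receives 'err' sends help to itself too, and so executes the base protocol
  without having decided. Its decisions are then those of the embedded run, four time units
  later.\<close>

lemma decides_late:
  assumes "i \<in> correct n r" "got_err n (state i 3)"
  shows "decides r i d \<longleftrightarrow> decides base_run i d"
proof
  assume "decides r i d"
  then obtain m where m: "decision (acts r m i) = Some d"
    by (auto simp: decides_def decides_at_def)
  have "4 \<le> m"
  proof (rule ccontr)
    assume "\<not> 4 \<le> m"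
    then have "m < 3 \<or> m = 3" by linarith
    then show False using m no_decision_before[OF assms(1)] assms by (auto simp: acts_3)
  qed
  then obtain m' where "m = 4 + m'" using le_Suc_ex by blast
  then show "decides base_run i d"
    using m assms got_help_if_err[OF assms assms(1)] by (auto simp: acts_base base_run_decides)
next
  assume "decides base_run i d"
  then obtain m where "decision (base_action m i) = Some d"
    using assms(1) by (auto simp: base_run_decides)
  then have "decides_at r i (4 + m) d"
    using assms got_help_if_err[OF assms assms(1)] by (simp add: decides_at_def acts_base)
  then show "decides r i d" by (auto simp: decides_def)
qed

lemma consensus:
  assumes "consensus_protocol n t Base"
  shows "Decision n r \<and> Agreement n r \<and> Validity n r"
proof (cases "\<exists>j\<in>correct n r. got_err n (state j 3)")
  case False
  then have dec: "decides r i d \<longleftrightarrow> d = estimate i" if "i \<in> correct n r" for i d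
    using decides_early[OF that] False that by simp
  have "Decision n r"
    unfolding Decision_def using dec by blast
  moreover have "Agreement n r"
    unfolding Agreement_def
  proof (intro ballI allI impI)
    fix i j d d'
    assume i: "i \<in> correct n r" and j: "j \<in> correct n r" and "decides r i d" "decides r j d'"
    then show "d = d'"
      using False estimate_agree_if_no_err[OF j _ i] by (simp add: dec)
  qed
  moreover have "Validity n r"
    unfolding Validity_def by (intro allI impI ballI) (simp only: dec estimate_valid)
  ultimately show ?thesis by blast
next
  case True
  \<comment> \<open>The process that received 'err' is correct and sends help to all, so no correct
    process halts.\<close>
  then have "is_run n t Base base_run"
    by (auto intro: is_run_base_run got_help_if_err)
  then have base: "Decision n base_run" "Agreement n base_run" "Validity n base_run"
    using assms by (auto simp: consensus_protocol_def)
  have base_valid: "decides base_run i v"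
    if "\<forall>j\<in>correct n r. estimate j = v" "i \<in> correct n r" for i v
    using base(3)[unfolded Validity_def correct_base_run inits_base_run, rule_format, OF _ that(2)]
      that(1) by simp
  have base_eq: "d = d'"
    if "i \<in> correct n r" "j \<in> correct n r" "decides base_run i d" "decides base_run j d'" for i j d d'
    using base(2)[unfolded Agreement_def correct_base_run, rule_format, OF that] .
  \<comment> \<open>Once early and late deciders alike decide as in the embedded run, the three
    properties carry over from there.\<close>
  have dec: "decides r i d \<longleftrightarrow> decides base_run i d" if i: "i \<in> correct n r" for i d
  proof (cases "got_err n (state i 3)")
    case True
    show ?thesis by (rule decides_late[OF i True])
  next
    case False
    \<comment> \<open>No 'err' reached \<open>i\<close>, so all correct processes enter the embedded
      run with the estimate of \<open>i\<close>, and validity applies.\<close>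
    have est: "decides base_run i (estimate i)"
      by (rule base_valid[OF _ i]) (rule ballI, rule estimate_agree_if_no_err[OF i False])
    have "(d = estimate i) = decides base_run i d"
    proof
      show "d = estimate i \<Longrightarrow> decides base_run i d" using est by simp
      \<comment> \<open>Agreement of \<open>i\<close> with itself makes its decision in the embedded
        run unique.\<close>
      show "decides base_run i d \<Longrightarrow> d = estimate i" using base_eq[OF i i _ est] .
    qed
    then show ?thesis unfolding decides_early[OF i False] .
  qed
  show ?thesis
  proof (intro conjI)
    show "Decision n r"
      unfolding Decision_def
    proof
      fix i assume i: "i \<in> correct n r"
      then obtain d where "decides base_run i d"
        using base(1) unfolding Decision_def correct_base_run by blast
      then show "\<exists>d. decides r i d" using dec[OF i] by blast
    qed
    show "Agreement n r"
      unfolding Agreement_def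
    proof (intro ballI allI impI)
      fix i j d d'
      assume ij: "i \<in> correct n r" "j \<in> correct n r" and "decides r i d" "decides r j d'"
      then show "d = d'" using base_eq[OF ij] dec[OF ij(1)] dec[OF ij(2)] by blast
    qed
    show "Validity n r"
      unfolding Validity_def
    proof (intro allI impI ballI)
      fix v i
      assume v: "\<forall>i\<in>correct n r. inits r i = v" and i: "i \<in> correct n r"
      have "decides base_run i v"
        by (rule base_valid[OF _ i]) (rule ballI, rule estimate_valid[OF v])
      then show "decides r i v" using dec[OF i] by blast
    qed
  qed
qed

subsection \<open>Communication\<close>

lemma layer_message:
  assumes "i \<in> correct n r" and "m < 4" and "msgs (acts r m i) j = Some x"
  shows "msg_bits c x = 1" and "x \<noteq> BaseMsg y"
proof -
  consider "m = 0" | "m = 1" | "m = 2" | "m = 3" using assms(2) by linarith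
  then have "msg_bits c x = 1 \<and> x \<noteq> BaseMsg y"
    by cases (use assms(1,3) in \<open>auto simp: acts_0 acts_1[unfolded One_nat_def] acts_2 acts_3
          silent_def to_all_def split: if_splits\<close>)
  then show "msg_bits c x = 1" and "x \<noteq> BaseMsg y" by auto
qed

lemma round_bits_layer:
  "m < 4 \<Longrightarrow> round_bits (msg_bits c) n r m =
     (\<Sum>i\<in>correct n r. card {j \<in> {..<n} - {i}. msgs (acts r m i) j \<noteq> None})"
  by (rule round_bits_eq_card) (rule layer_message)

text \<open>A vote goes to at most half of the \<open>t + 1\<close> members, rounded up, hence to at
  most \<open>(t + 2) / 2\<close> of them. Doubling keeps the bound in the naturals.\<close>

lemma round_bits_0: "2 * round_bits (msg_bits c) n r 0 \<le> n * (t + 2)"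
proof -
  have "2 * card {j \<in> {..<n} - {i}. msgs (acts r 0 i) j \<noteq> None} \<le> t + 2"
    if "i \<in> correct n r" for i
  proof -
    have "card {j \<in> {..<n} - {i}. msgs (acts r 0 i) j \<noteq> None} \<le>
        card {j. j < Suc t \<and> odd j \<noteq> inits r i}"
      using that by (intro card_mono) (auto simp: acts_0 split: if_splits)
    also have "\<dots> \<le> Suc (Suc t) div 2"
      unfolding card_parity by auto
    finally show ?thesis by linarith
  qed
  then have "2 * round_bits (msg_bits c) n r 0 \<le> (\<Sum>i\<in>correct n r. t + 2)"
    unfolding round_bits_layer[OF zero_less_numeral] sum_distrib_left by (rule sum_mono)
  also have "\<dots> \<le> n * (t + 2)"
    using card_correct_le[of n r] by (simp only: sum_constant of_nat_id mult_le_mono1)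
  finally show ?thesis .
qed

text \<open>Only the \<open>t + 1\<close> council members send. The bounds for single members
  alternate between the two roundings of \<open>n / 2\<close>, so that the roundings cancel in
  pairs.\<close>

lemma round_bits_1: "2 * round_bits (msg_bits c) n r 1 \<le> Suc t * n"
proof -
  let ?h = "\<lambda>i. if odd i then Suc n div 2 else n div 2"
  have "card {j \<in> {..<n} - {i}. msgs (acts r 1 i) j \<noteq> None} \<le> (if i < Suc t then ?h i else 0)"
    if "i \<in> correct n r" for i
  proof -
    have "{j \<in> {..<n} - {i}. msgs (acts r 1 i) j \<noteq> None} =
        (if i < Suc t then {j \<in> {..<n} - {i}. odd j \<noteq> rec i} else {})"
      using acts_1[OF that] by auto
    then show ?thesis
      using card_parity_others[OF correct_less[OF that], of "rec i"] by simp
  qed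
  then have "round_bits (msg_bits c) n r 1 \<le>
      (\<Sum>i\<in>correct n r. if i < Suc t then ?h i else 0)"
    by (subst round_bits_layer) (simp_all only: sum_mono one_less_numeral_iff semiring_norm)
  also have "\<dots> = sum ?h {i \<in> correct n r. i < Suc t}"
    by (simp add: sum.inter_filter)
  also have "\<dots> \<le> sum ?h {..<Suc t}"
    by (rule sum_mono2) auto
  finally show ?thesis using sum_parity_halves[of n "Suc t"] by linarith
qed

lemma round_bits_layer_le:
  assumes "m < 4"
  shows "round_bits (msg_bits c) n r m \<le> n * n"
proof -
  have "card {j \<in> {..<n} - {i}. msgs (acts r m i) j \<noteq> None} \<le> n" for i
    using card_mono[of "{..<n}" "{j \<in> {..<n} - {i}. msgs (acts r m i) j \<noteq> None}"] by auto
  then have "round_bits (msg_bits c) n r m \<le> (\<Sum>i\<in>correct n r. n)"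
    unfolding round_bits_layer[OF assms] by (rule sum_mono)
  also have "\<dots> \<le> n * n"
    using card_correct_le[of n r] by (simp only: sum_constant of_nat_id mult_le_mono1)
  finally show ?thesis .
qed

text \<open>Half of \<open>t + 2\<close> from the first round and half of \<open>t + 1\<close> from
  the second add up to \<open>t + 3 / 2\<close> per process.\<close>

lemma round_bits_01:
  "real (round_bits (msg_bits c) n r 0 + round_bits (msg_bits c) n r 1)
     \<le> real n * (real t + 3 / 2)"
proof -
  have "2 * (round_bits (msg_bits c) n r 0 + round_bits (msg_bits c) n r 1)
      \<le> n * (t + 2) + Suc t * n"
    using round_bits_0[of c] round_bits_1[of c] by (simp only: distrib_left add_mono)
  then have "2 * real (round_bits (msg_bits c) n r 0 + round_bits (msg_bits c) n r 1)
      \<le> real (n * (t + 2) + Suc t * n)"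
    by (metis of_nat_le_iff of_nat_mult of_nat_numeral)
  then show ?thesis by (simp add: algebra_simps)
qed

lemma bits_sent_layer:
  "real (bits_sent (msg_bits c) n r 4) \<le> real n * (real t + 3 / 2) + 2 * (real n)\<^sup>2"
proof -
  have "bits_sent (msg_bits c) n r 4 =
      (round_bits (msg_bits c) n r 0 + round_bits (msg_bits c) n r 1)
      + (round_bits (msg_bits c) n r 2 + round_bits (msg_bits c) n r 3)"
    by (simp add: bits_sent_eq_sum_round_bits eval_nat_numeral)
  moreover have "real (round_bits (msg_bits c) n r 2 + round_bits (msg_bits c) n r 3)
      \<le> real (2 * (n * n))"
    using round_bits_layer_le[of 2 c] round_bits_layer_le[of 3 c]
    unfolding of_nat_le_iff by simp
  ultimately show ?thesis
    using round_bits_01[of c] by (simp add: power2_eq_square)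
qed

lemma no_base_message:
  "i \<in> correct n r \<Longrightarrow> m < 4 \<Longrightarrow> msgs (acts r m i) j \<noteq> Some (BaseMsg x)"
  using layer_message(2) by blast

text \<open>The alternative is settled for each process separately, because faulty processes may
  send help to only some of the correct ones.\<close>

lemma reverts_or_halts:
  assumes "i \<in> correct n r"
  shows "if got_help n (state i 4) then reverts_at n Base r i 4 (est t i (state i 4))
    else halts_at r i 4"
proof -
  have "base_input i = (\<lambda>l. base_part \<circ> received n r i (4 + l))"
    by (simp add: fun_eq_iff base_input_def)
  then show ?thesis
    using no_base_message[OF assms] acts_base[OF assms] acts_halted[OF assms]
    by (simp add: reverts_at_def halts_at_def est_state base_action_def)
qed

subsection \<open>Failure-free runs\<close>

context
  assumes failure_free: "failure_free r"
begin

lemma correct_failure_free: "correct n r = {..<n}"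
  using failure_free by (simp add: correct_def failure_free_def)

text \<open>Without failures every member decodes the true vote of every process, so all members
  compute the same majority.\<close>

lemma rec_failure_free: "j \<le> t \<Longrightarrow> rec j = MAJ n (inits r)"
  unfolding rec_def council_rec_def
  by (rule MAJ_cong) (simp add: council_values_correct[unfolded One_nat_def] correct_failure_free)

lemma recommendation_failure_free:
  "i < n \<Longrightarrow> j \<le> t \<Longrightarrow> recommendation i (state i 2) j = MAJ n (inits r)"
  using recommendation_correct[of j i] rec_failure_free[of j] resilience
  by (simp add: correct_failure_free)

lemma unanimity_failure_free: "i < n \<Longrightarrow> unanimity i"
  by (simp add: unanimity_def unanimous_def recommendation_failure_free)

lemma estimate_failure_free: "i < n \<Longrightarrow> estimate i = MAJ n (inits r)"
  using unanimity_failure_free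
  by (simp add: estimate_def est_def unanimity_def recommendation_failure_free)

lemma no_err_failure_free: "i < n \<Longrightarrow> \<not> got_err n (state i 3)"
  by (simp add: got_err_def received_def acts_2 correct_failure_free unanimity_failure_free
      silent_def)

lemma no_help_failure_free: "i < n \<Longrightarrow> \<not> got_help n (state i 4)"
  by (simp add: got_help_def received_def acts_3 correct_failure_free no_err_failure_free)

lemma decides_at_failure_free:
  "i < n \<Longrightarrow> decides_at r i m d \<longleftrightarrow> m = 3 \<and> d = MAJ n (inits r)"
  by (simp add: decides_at_early correct_failure_free no_err_failure_free estimate_failure_free)

lemma round_bits_failure_free:
  assumes "2 \<le> m"
  shows "round_bits c n r m = 0"
proof -
  consider "m = 2" | "m = 3" | "4 \<le> m" using assms by linarith
  then have "msgs (acts r m i) j = None" if "i < n" for i j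
    by cases (use that in \<open>simp_all add: acts_2 acts_3 acts_halted correct_failure_free
          unanimity_failure_free no_err_failure_free no_help_failure_free silent_def\<close>)
  then show ?thesis by (simp add: round_bits_def correct_failure_free)
qed

lemma bits_sent_failure_free:
  "real (bits_sent (msg_bits c) n r T) \<le> real n * (real t + 3 / 2)"
proof -
  \<comment> \<open>Extending the range to \<open>2 + T\<close> makes it contain the first two
    rounds even when \<open>T\<close> is below 2; the remaining rounds contribute nothing.\<close>
  have "bits_sent (msg_bits c) n r T \<le> (\<Sum>m<2 + T. round_bits (msg_bits c) n r m)"
    unfolding bits_sent_eq_sum_round_bits by (rule sum_mono2) auto
  also have "\<dots> = (\<Sum>m<2. round_bits (msg_bits c) n r m)"
    by (rule sum.mono_neutral_right) (auto simp: round_bits_failure_free)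
  also have "\<dots> = round_bits (msg_bits c) n r 0 + round_bits (msg_bits c) n r 1"
    by (simp add: eval_nat_numeral)
  finally show ?thesis using round_bits_01[of c] by linarith
qed

end

end

theorem theorem3:
  fixes k n t :: nat
    and Base :: "(bool, 'm) protocol"
    and base_bits :: "'m \<Rightarrow> nat"
  assumes "k \<ge> 3" and "n > 2" and "t \<ge> 1" and "n > k * t"
    and "consensus_protocol n t Base"
  shows "consensus_protocol n t (CC3 n t Base)
    \<and> (\<forall>r. is_run n t (CC3 n t Base) r \<and> failure_free r \<longrightarrow>
         (\<forall>i<n. \<exists>d. decides_at r i 3 d) \<and>
         (\<forall>i<n. \<forall>m d. decides_at r i m d \<longrightarrow> m = 3) \<and>
         (\<forall>T. real (bits_sent (msg_bits base_bits) n r T) \<le> real n * (real t + 3 / 2)))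
    \<and> (\<forall>r. is_run n t (CC3 n t Base) r \<and> \<not> failure_free r \<longrightarrow>
         real (bits_sent (msg_bits base_bits) n r 4)
           \<le> real n * (real t + 3 / 2) + 2 * (real n)^2 \<and>
         (\<forall>i\<in>correct n r.
            if got_help n (local_state n r i 4)
            then reverts_at n Base r i 4 (est t i (local_state n r i 4))
            else halts_at r i 4))
    \<and> (\<forall>r. is_run n t (CC3 n t Base) r \<and> failure_free r \<longrightarrow>
         (\<forall>i<n. \<forall>d. decides r i d \<longleftrightarrow> d = MAJ n (inits r)))"
proof -
  have "3 * t < n"
    using mult_le_mono1[OF assms(1), of t] assms(4) by linarith
  then have run: "CC3_run n t Base r" if "is_run n t (CC3 n t Base) r" for r
    using that by unfold_locales
  show ?thesis
  proof (intro conjI allI impI)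
    show "consensus_protocol n t (CC3 n t Base)"
      using CC3_run.consensus[OF run assms(5)] by (simp add: consensus_protocol_def)
  next
    fix r i m d
    assume "is_run n t (CC3 n t Base) r \<and> failure_free r" and "i < n"
    then have dec: "decides_at r i m d \<longleftrightarrow> m = 3 \<and> d = MAJ n (inits r)" for m d
      using run CC3_run.decides_at_failure_free by blast
    show "\<exists>d. decides_at r i 3 d" by (simp add: dec)
    show "decides_at r i m d \<Longrightarrow> m = 3" by (simp add: dec)
    show "decides r i d \<longleftrightarrow> d = MAJ n (inits r)" by (simp add: decides_def dec)
  next
    fix r T
    assume "is_run n t (CC3 n t Base) r \<and> failure_free r"
    then show "real (bits_sent (msg_bits base_bits) n r T) \<le> real n * (real t + 3 / 2)"
      using run CC3_run.bits_sent_failure_free by blast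
  next
    fix r
    assume "is_run n t (CC3 n t Base) r \<and> \<not> failure_free r"
    then have *: "CC3_run n t Base r" using run by blast
    show "real (bits_sent (msg_bits base_bits) n r 4)
        \<le> real n * (real t + 3 / 2) + 2 * (real n)^2"
      using * by (rule CC3_run.bits_sent_layer)
    show "\<forall>i\<in>correct n r.
        if got_help n (local_state n r i 4)
        then reverts_at n Base r i 4 (est t i (local_state n r i 4))
        else halts_at r i 4"
      using CC3_run.reverts_or_halts[OF *] by blast
  qed
qed

end
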